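(* Let $\alpha\in(0,1]$ and $A\in C(\mathbb{R},\mathbb{R}^{n\times n})$. If $x_1,x_2:\mathbb{R}\to\mathbb{R}^n$ are both solutions of $\mathcal{T}^\alpha x=A(t)x$, then $a_1x_1+a_2x_2$ is also a solution for any $a_1,a_2\in\mathbb{R}$. Moreover, the set of all solutions of $\mathcal{T}^\alpha x=A(t)x$ is an $n$-dimensional (real) linear space.
   Context: For $\alpha\in(0,1]$ the $\alpha$-conformable fractional derivative is $\mathcal{T}^\alpha g(t):=\lim_{\varepsilon\to0}\frac{g(t+\varepsilon|t|^{1-\alpha})-g(t)}{\varepsilon}$ (so $\mathcal{T}^\alpha g(t)=|t|^{1-\alpha}g'(t)$ for $t\ne0$), with $\mathcal{T}^\alpha g(0):=\lim_{t\to0}\mathcal{T}^\alpha g(t)$ if this limit exists. Solutions are continuous functions on $\mathbb{R}$ satisfying the equation. *)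

theory Defs
  imports "HOL-Analysis.Analysis" "HOL-Library.Function_Algebras"
begin

text \<open>The defining limit of the conformable derivative. It is only used at points
  \<open>t \<noteq> 0\<close>, so that the convention \<open>0 powr 0 = 0\<close> is irrelevant (also for \<open>\<alpha> = 1\<close>).\<close>

definition has_conformable_limit ::
    "real \<Rightarrow> (real \<Rightarrow> 'a::real_normed_vector) \<Rightarrow> 'a \<Rightarrow> real \<Rightarrow> bool"
  where "has_conformable_limit \<alpha> g D t \<longleftrightarrow>
    ((\<lambda>\<epsilon>. (g (t + \<epsilon> * \<bar>t\<bar> powr (1 - \<alpha>)) - g t) /\<^sub>R \<epsilon>) \<longlongrightarrow> D) (at 0)"

text \<open>\<open>has_conformable_derivative \<alpha> g D t\<close> says that the \<open>\<alpha>\<close>-conformable derivative of \<open>g\<close>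
  at \<open>t\<close> exists and equals \<open>D\<close>. At the origin it is the limit of the derivatives \<open>h s\<close> at
  the points \<open>s \<noteq> 0\<close>, which therefore have to exist near the origin.\<close>

definition has_conformable_derivative ::
    "real \<Rightarrow> (real \<Rightarrow> 'a::real_normed_vector) \<Rightarrow> 'a \<Rightarrow> real \<Rightarrow> bool"
  where "has_conformable_derivative \<alpha> g D t \<longleftrightarrow>
    (if t = 0
     then \<exists>h. (\<forall>\<^sub>F s in at 0. has_conformable_limit \<alpha> g (h s) s) \<and> (h \<longlongrightarrow> D) (at 0)
     else has_conformable_limit \<alpha> g D t)"

definition conformable_solution ::
    "real \<Rightarrow> (real \<Rightarrow> real ^ 'n ^ 'n) \<Rightarrow> (real \<Rightarrow> real ^ 'n) \<Rightarrow> bool"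
  where "conformable_solution \<alpha> A x \<longleftrightarrow>
    continuous_on UNIV x \<and> (\<forall>t. has_conformable_derivative \<alpha> x (A t *v x t) t)"

text \<open>Function types are not an instance of \<open>real_vector\<close>. Addition of functions is the
  pointwise one of \<open>Function_Algebras\<close>; together with the following scaling it makes the
  functions \<open>real \<Rightarrow> real ^ 'n\<close> a real vector space in the sense of the locale
  \<open>vector_space\<close>, whose notions of subspace and dimension then apply.\<close>

definition scale_fun :: "real \<Rightarrow> ('b \<Rightarrow> 'a::real_vector) \<Rightarrow> 'b \<Rightarrow> 'a"
  where "scale_fun c f = (\<lambda>t. c *\<^sub>R f t)"

interpretation fun_space: vector_space "scale_fun :: real \<Rightarrow> ('b \<Rightarrow> 'a::real_vector) \<Rightarrow> 'b \<Rightarrow> 'a"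
  by unfold_locales (auto simp: scale_fun_def fun_eq_iff algebra_simps)

end

theory Submission
  imports Defs
begin

text \<open>
  Away from the origin the equation reads \<open>x' = \<bar>t\<bar> powr (\<alpha> - 1) *\<^sub>R (A t *v x)\<close>, and the condition
  at the origin then holds automatically by continuity. The time change
  \<open>s = sgn t * \<bar>t\<bar> powr \<alpha> / \<alpha>\<close> removes the singular factor, so existence for every initial value
  reduces to Picard iteration for a linear equation with continuous coefficients. Uniqueness is a
  Gronwall argument for a solution with \<open>x 0 = 0\<close>: on \<open>[0, t]\<close> the function \<open>\<parallel>x\<parallel>\<^sup>2 exp (- 2 M s)\<close> is nonincreasing, where \<open>M\<close> bounds
  \<open>A\<close>; negative times follow by reflection. Hence \<open>x \<mapsto> x 0\<close> is a linear
  isomorphism from the space of solutions onto \<open>\<real>\<^sup>n\<close>.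
\<close>

section \<open>Matrix-vector products with continuous coefficients\<close>

lemma bounded_bilinear_matrix_vector_mult:
  "bounded_bilinear ((*v) :: real ^ 'n ^ 'm \<Rightarrow> real ^ 'n \<Rightarrow> real ^ 'm)"
  unfolding bilinear_conv_bounded_bilinear [symmetric] bilinear_def
  by (auto intro!: linearI simp: matrix_vector_mult_add_rdistrib matrix_vector_right_distrib
      scaleR_matrix_vector_assoc matrix_vector_mult_scaleR)

lemmas continuous_on_matrix_vector_mult =
  bounded_bilinear.continuous_on [OF bounded_bilinear_matrix_vector_mult]

lemma matrix_family_bounded_on_compact:
  fixes A :: "real \<Rightarrow> real ^ 'n ^ 'm"
  assumes "continuous_on UNIV A" and "compact S"
  obtains M where "M > 0" and "\<And>t v. t \<in> S \<Longrightarrow> norm (A t *v v) \<le> M * norm v"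
proof -
  obtain C where C: "\<And>t. t \<in> S \<Longrightarrow> norm (A t) \<le> C"
    using compact_imp_bounded [OF compact_continuous_image [OF continuous_on_subset [OF assms(1)] assms(2)]]
    unfolding bounded_iff by auto
  obtain K where K: "K > 0" "\<And>(X :: real ^ 'n ^ 'm) v. norm (X *v v) \<le> norm X * norm v * K"
    using bounded_bilinear.pos_bounded [OF bounded_bilinear_matrix_vector_mult] by auto
  \<comment> \<open>Passing from \<open>C\<close> to \<open>max C 0 + 1\<close> makes the constant
    positive even when \<open>S\<close> is empty and \<open>C\<close> is arbitrary.\<close>
  have "norm (A t *v v) \<le> (max C 0 + 1) * K * norm v" if "t \<in> S" for t v
  proof -
    have "norm (A t *v v) \<le> norm (A t) * norm v * K" by (rule K)
    also have "\<dots> \<le> (max C 0 + 1) * norm v * K"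
      using C [OF that] K(1) by (intro mult_right_mono) auto
    finally show ?thesis by (simp add: mult_ac)
  qed
  moreover have "(max C 0 + 1) * K > 0" using K(1) by simp
  ultimately show ?thesis using that by blast
qed

section \<open>Picard iteration for linear equations on the whole line\<close>

lemma continuous_antiderivative:
  fixes f :: "real \<Rightarrow> 'a::euclidean_space"
  assumes "continuous_on UNIV f"
  obtains F where "F 0 = 0" and "\<And>t. (F has_vector_derivative f t) (at t)"
proof -
  have "isCont f x" for x using assms by (simp add: continuous_on_eq_continuous_at)
  then obtain F where "\<And>x. (F has_vector_derivative f x) (at x)"
    using einterval_antiderivative [of "-\<infinity>" "\<infinity>" f] by auto
  then have "((\<lambda>x. F x - F 0) has_vector_derivative f t) (at t)" for t
    by (auto intro!: derivative_eq_intros)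
  then show ?thesis using that [of "\<lambda>x. F x - F 0"] by simp
qed

text \<open>Inductive step of the Picard estimate: the mean value inequality compares
  \<open>F\<close> with the antiderivative of the bound on \<open>f\<close>. Repeated use
  accumulates the factors \<open>1 / Suc k\<close> to \<open>1 / fact k\<close>.\<close>

lemma antiderivative_power_bound:
  fixes F :: "real \<Rightarrow> 'a::real_normed_vector"
  assumes "F 0 = 0" and F: "\<And>t. (F has_vector_derivative f t) (at t)"
    and f: "\<And>t. \<bar>t\<bar> \<le> R \<Longrightarrow> norm (f t) \<le> C * \<bar>t\<bar> ^ k" and "\<bar>t\<bar> \<le> R"
  shows "norm (F t) \<le> C * \<bar>t\<bar> ^ Suc k / Suc k"
proof -
  \<comment> \<open>Stated for arbitrary \<open>G\<close> and \<open>g\<close>, so that it serves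
    both \<open>F\<close> and, for negative times, its reflection
    \<open>\<lambda>t. F (- t)\<close>.\<close>
  have pos: "norm (G s) \<le> C * s ^ Suc k / Suc k"
    if "G 0 = 0" and G: "\<And>t. (G has_vector_derivative g t) (at t)"
      and g: "\<And>t. \<bar>t\<bar> \<le> R \<Longrightarrow> norm (g t) \<le> C * \<bar>t\<bar> ^ k" and s: "0 < s" "s \<le> R"
    for G g s
  proof -
    have "norm (G s - G 0) \<le> C * s ^ Suc k / Suc k - C * 0 ^ Suc k / Suc k"
    proof (rule differentiable_bound_general [OF \<open>0 < s\<close>])
      show "continuous_on {0..s} G"
        using G by (intro continuous_at_imp_continuous_on) (auto intro: has_vector_derivative_continuous)
      show "continuous_on {0..s} (\<lambda>s. C * s ^ Suc k / Suc k)"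
        by (intro continuous_intros) simp
      show "((\<lambda>s. C * s ^ Suc k / Suc k) has_vector_derivative C * x ^ k) (at x)" for x
        unfolding has_real_derivative_iff_has_vector_derivative [symmetric]
        by (rule derivative_eq_intros refl | simp)+
      show "norm (g x) \<le> C * x ^ k" if "0 < x" "x < s" for x
        using g [of x] that s by simp
    qed (use G in auto)
    then show ?thesis using \<open>G 0 = 0\<close> by simp
  qed
  consider "t = 0" | "t > 0" | "t < 0" by linarith
  then show ?thesis
  proof cases
    case 3
    have "((\<lambda>t. F (- t)) has_vector_derivative - f (- t)) (at t)" for t
      using vector_diff_chain_at [of uminus "-1" t F "f (- t)"] F
      by (simp add: o_def has_vector_derivative_minus [OF has_vector_derivative_id])
    note F' = this
    have f': "norm (- f (- t)) \<le> C * \<bar>t\<bar> ^ k" if "\<bar>t\<bar> \<le> R" for t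
      using f [of "- t"] that by simp
    show ?thesis using pos [OF _ F' f', of "- t"] 3 assms(1,4) by simp
  qed (use pos [OF _ F f] assms in auto)
qed

text \<open>The solution is the series of increments of the Picard iterates. On
  \<open>\<bar>t\<bar> \<le> R\<close> these are dominated by the terms of an exponential series, so
  differentiation term by term is legitimate; \<open>R\<close> is arbitrary.\<close>

lemma linear_ode_exists:
  fixes B :: "real \<Rightarrow> real ^ 'n ^ 'n" and v :: "real ^ 'n"
  assumes B: "continuous_on UNIV B"
  obtains y where "y 0 = v" and "\<And>t. (y has_vector_derivative B t *v y t) (at t)"
proof -
  \<comment> \<open>\<open>J f\<close> is the antiderivative of \<open>f\<close> vanishing at 0,
    that is, the integral operator of the Picard iteration.\<close>
  obtain J :: "(real \<Rightarrow> real ^ 'n) \<Rightarrow> real \<Rightarrow> real ^ 'n"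
    where J: "\<And>f. continuous_on UNIV f \<Longrightarrow> J f 0 = 0 \<and> (\<forall>t. (J f has_vector_derivative f t) (at t))"
    using continuous_antiderivative by metis
  \<comment> \<open>\<open>u k\<close> is an increment, not an iterate: the iterates starting from
    the constant \<open>v\<close> are the partial sums of \<open>u\<close>.\<close>
  define u where "u = rec_nat (\<lambda>_. v) (\<lambda>_ g. J (\<lambda>t. B t *v g t))"
  have u_simps: "u 0 = (\<lambda>_. v)" "u (Suc k) = J (\<lambda>t. B t *v u k t)" for k
    by (simp_all add: u_def)
  have cont: "continuous_on UNIV (u k)" for k
  proof (induction k)
    case (Suc k)
    show ?case unfolding u_simps
      using J [OF continuous_on_matrix_vector_mult [OF B Suc]]
      by (intro continuous_at_imp_continuous_on) (auto intro: has_vector_derivative_continuous)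
  qed (simp add: u_simps)
  have uSuc: "u (Suc k) 0 = 0" "(u (Suc k) has_vector_derivative B t *v u k t) (at t)" for k t
    unfolding u_simps using J [OF continuous_on_matrix_vector_mult [OF B cont]] by auto
  \<comment> \<open>\<open>d k\<close> is the derivative of \<open>u k\<close>. The index shift with
    \<open>d 0 = 0\<close> turns the sum of the \<open>d k\<close> into \<open>B t\<close> applied
    to the sum of the \<open>u k\<close>, which is the differential equation for
    \<open>y\<close>.\<close>
  define d where "d k t = (case k of 0 \<Rightarrow> 0 | Suc j \<Rightarrow> B t *v u j t)" for k t
  have d: "(u k has_vector_derivative d k t) (at t)" for k t
    by (cases k) (auto simp: d_def uSuc(2), simp add: u_simps)
  define y where "y t = (\<Sum>k. u k t)" for t
  \<comment> \<open>What term-by-term differentiation asks for: convergence of the series itself at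
    each point, and uniform convergence of the differentiated series.\<close>
  have picard: "(\<forall>t. \<bar>t\<bar> \<le> R \<longrightarrow> (\<lambda>k. u k t) sums y t) \<and>
     uniform_limit {-R<..<R} (\<lambda>n t. \<Sum>k<n. d k t) (\<lambda>t. B t *v y t) sequentially"
    if "R > 0" for R
  proof -
    obtain M where M: "M > 0" "\<And>t w. \<bar>t\<bar> \<le> R \<Longrightarrow> norm (B t *v w) \<le> M * norm w"
      using matrix_family_bounded_on_compact [OF B compact_Icc [of "-R" R]]
      by (metis abs_le_iff atLeastAtMost_iff minus_le_iff)
    have bound: "norm (u k t) \<le> norm v * M ^ k / fact k * \<bar>t\<bar> ^ k" if "\<bar>t\<bar> \<le> R" for k t
      using that
    proof (induction k arbitrary: t)
      case (Suc k)
      have "norm (B t *v u k t) \<le> M * (norm v * M ^ k / fact k) * \<bar>t\<bar> ^ k" if "\<bar>t\<bar> \<le> R" for t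
      proof -
        have "norm (B t *v u k t) \<le> M * norm (u k t)" using M(2) that by blast
        also have "\<dots> \<le> M * (norm v * M ^ k / fact k * \<bar>t\<bar> ^ k)"
          using Suc.IH [OF that] M(1) by (intro mult_left_mono) auto
        finally show ?thesis by (simp add: mult.assoc)
      qed
      from antiderivative_power_bound [OF uSuc this Suc.prems]
      show ?case by (simp add: field_simps)
    qed (simp add: u_simps)
    \<comment> \<open>The estimate \<open>bound\<close> at its worst case
      \<open>\<bar>t\<bar> = R\<close>: a multiple of the exponential series of
      \<open>M * R\<close>.\<close>
    define c where "c k = norm v * ((M * R) ^ k /\<^sub>R fact k)" for k
    have c: "summable c" unfolding c_def by (intro summable_mult summable_exp_generic)
    have uc: "norm (u k t) \<le> c k" if "\<bar>t\<bar> \<le> R" for k t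
    proof -
      have "norm v * M ^ k / fact k * \<bar>t\<bar> ^ k \<le> norm v * M ^ k / fact k * R ^ k"
        using M(1) that by (intro mult_left_mono power_mono) auto
      with bound [OF that, of k] show ?thesis
        by (simp add: c_def power_mult_distrib field_simps)
    qed
    have sums: "(\<lambda>k. u k t) sums y t" if "\<bar>t\<bar> \<le> R" for t
      unfolding y_def by (rule summable_sums, rule summable_comparison_test' [OF c]) (use uc that in auto)
    have dsums: "(\<lambda>k. d k t) sums (B t *v y t)" if "\<bar>t\<bar> \<le> R" for t
      using bounded_linear.sums [OF matrix_vector_mul_bounded_linear sums [OF that], of "B t"]
        sums_Suc_iff [of "\<lambda>k. d k t" "B t *v y t"]
      by (simp add: d_def)
    \<comment> \<open>Majorant for \<open>d\<close>, with the same index shift as in the definition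
      of \<open>d\<close>.\<close>
    define c' where "c' k = (case k of 0 \<Rightarrow> 0 | Suc j \<Rightarrow> M * c j)" for k
    have "summable (\<lambda>k. c' (Suc k))" unfolding c'_def using c by (simp add: summable_mult)
    then have c': "summable c'" by (simp add: summable_Suc_iff)
    have dc: "norm (d k t) \<le> c' k" if "\<bar>t\<bar> \<le> R" for k t
    proof (cases k)
      case (Suc j)
      have "norm (B t *v u j t) \<le> M * norm (u j t)" using M(2) that by blast
      also have "\<dots> \<le> M * c j" using uc [OF that] M(1) by simp
      finally show ?thesis by (simp add: Suc d_def c'_def)
    qed (simp add: d_def c'_def)
    have "uniform_limit {-R<..<R} (\<lambda>n t. \<Sum>k<n. d k t) (\<lambda>t. \<Sum>k. d k t) sequentially"
      by (rule Weierstrass_m_test [OF _ c']) (use dc in auto)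
    moreover have "(\<Sum>k. d k t) = B t *v y t" if "t \<in> {-R<..<R}" for t
      using dsums [of t] that by (auto simp: sums_iff)
    ultimately have "uniform_limit {-R<..<R} (\<lambda>n t. \<Sum>k<n. d k t) (\<lambda>t. B t *v y t) sequentially"
      by (subst (asm) uniform_limit_cong') auto
    with sums show ?thesis by blast
  qed
  have "(y has_vector_derivative B t *v y t) (at t)" for t
  proof -
    \<comment> \<open>Any radius above \<open>\<bar>t\<bar>\<close> works; it puts \<open>t\<close>
      into the open interval \<open>S\<close>, where the derivative within \<open>S\<close> is the
      full derivative.\<close>
    define R where "R = \<bar>t\<bar> + 1"
    define S where "S = {-R<..<R}"
    have R: "R > 0" and tS: "t \<in> S" "open S" by (auto simp: R_def S_def)
    have ysums: "(\<lambda>k. u k s) sums y s" if "s \<in> S" for s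
      using picard [OF R] that by (auto simp: S_def)
    \<comment> \<open>The series theorem yields some limit function \<open>g\<close>; uniqueness of
      sums identifies it with \<open>y\<close> on \<open>S\<close> below.\<close>
    have "\<exists>g. \<forall>x\<in>S. (\<lambda>k. u k x) sums g x \<and>
        (g has_derivative (\<lambda>h. h *\<^sub>R (B x *v y x))) (at x within S)"
    proof (rule has_derivative_series [where x = t and l = "y t"])
      show "convex S" by (simp add: S_def)
      show "(u n has_derivative (\<lambda>h. h *\<^sub>R d n x)) (at x within S)" for n x
        using has_vector_derivative_at_within [OF d [of n x]] by (simp add: has_vector_derivative_def)
      fix e :: real assume "e > 0"
      then have "\<forall>\<^sub>F n in sequentially. \<forall>x\<in>S. dist (\<Sum>k<n. d k x) (B x *v y x) < e"
        using picard [OF R] by (auto simp: uniform_limit_iff S_def)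
      then show "\<forall>\<^sub>F n in sequentially. \<forall>x\<in>S. \<forall>h. norm ((\<Sum>i<n. h *\<^sub>R d i x) - h *\<^sub>R (B x *v y x)) \<le> e * norm h"
      proof eventually_elim
        case (elim n)
        show ?case
        proof (intro ballI allI)
          fix x h assume "x \<in> S"
          have "norm ((\<Sum>i<n. h *\<^sub>R d i x) - h *\<^sub>R (B x *v y x))
              = norm h * dist (\<Sum>k<n. d k x) (B x *v y x)"
            by (simp add: dist_norm scaleR_right.sum [symmetric] scaleR_diff_right [symmetric])
          also have "\<dots> \<le> norm h * e" using elim \<open>x \<in> S\<close> by (intro mult_left_mono) (auto intro: less_imp_le)
          finally show "norm ((\<Sum>i<n. h *\<^sub>R d i x) - h *\<^sub>R (B x *v y x)) \<le> e * norm h"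
            by (simp add: mult.commute)
        qed
      qed
    qed (use tS ysums in auto)
    then obtain g where g: "\<And>x. x \<in> S \<Longrightarrow> (\<lambda>k. u k x) sums g x"
        "\<And>x. x \<in> S \<Longrightarrow> (g has_derivative (\<lambda>h. h *\<^sub>R (B x *v y x))) (at x within S)" by blast
    have "(g has_vector_derivative B t *v y t) (at t)"
      using g(2) [OF tS(1)] at_within_open [OF tS] by (simp add: has_vector_derivative_def)
    then show ?thesis
      by (rule has_vector_derivative_transform_within_open [OF _ tS(2) tS(1)])
        (use g(1) ysums in \<open>auto dest: sums_unique2\<close>)
  qed
  moreover have "y 0 = v"
  proof -
    \<comment> \<open>All increments after the first are antiderivatives normalised to vanish at 0,
      so only \<open>u 0\<close> contributes to \<open>y 0\<close>.\<close>
    have "u k 0 = (if k = 0 then v else 0)" for k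
      by (cases k) (auto simp: uSuc(1), simp add: u_simps)
    then have "(\<lambda>k. u k 0) sums v" using sums_single [of 0 "\<lambda>_. v"] by simp
    then show ?thesis by (simp add: y_def sums_iff)
  qed
  ultimately show ?thesis using that by blast
qed

section \<open>The time change\<close>

text \<open>The odd extension of the power function to the whole line. For \<alpha> > 0,
  \<open>odd_powr \<alpha> t / \<alpha>\<close> is the continuous antiderivative of
  \<open>\<bar>t\<bar> powr (\<alpha> - 1)\<close> that vanishes at 0.\<close>

definition odd_powr :: "real \<Rightarrow> real \<Rightarrow> real"
  where "odd_powr p t = sgn t * \<bar>t\<bar> powr p"

lemma odd_powr_0 [simp]: "odd_powr p 0 = 0"
  by (simp add: odd_powr_def)

lemma continuous_on_odd_powr:
  assumes "p > 0"
  shows "continuous_on S (odd_powr p)"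
proof -
  \<comment> \<open>Splitting into positive and negative parts removes the discontinuous
    \<open>sgn\<close>; both powers are continuous because \<open>p > 0\<close>.\<close>
  have "odd_powr p = (\<lambda>t. max t 0 powr p - max (- t) 0 powr p)"
    by (auto simp: fun_eq_iff odd_powr_def sgn_if)
  then show ?thesis using assms by (auto intro!: continuous_intros continuous_on_powr')
qed

lemma odd_powr_odd_powr_inverse:
  assumes "p \<noteq> 0"
  shows "odd_powr (1 / p) (odd_powr p t) = t"
  using assms
  by (auto simp: odd_powr_def sgn_mult abs_mult powr_powr sgn_if split: if_splits)

lemma has_real_derivative_odd_powr:
  assumes "t \<noteq> 0"
  shows "(odd_powr p has_real_derivative p * \<bar>t\<bar> powr (p - 1)) (at t)"
proof (cases "t > 0")
  case True
  have "((\<lambda>t. t powr p) has_real_derivative p * \<bar>t\<bar> powr (p - 1)) (at t)"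
    using True by (auto intro!: derivative_eq_intros simp: has_real_derivative_powr)
  then show ?thesis
    by (rule has_field_derivative_transform_within_open [where S = "{0<..}"])
      (use True in \<open>auto simp: odd_powr_def\<close>)
next
  case False
  have "((\<lambda>t. - ((- t) powr p)) has_real_derivative p * \<bar>t\<bar> powr (p - 1)) (at t)"
    using False assms by (auto intro!: derivative_eq_intros simp: powr_diff)
  then show ?thesis
    by (rule has_field_derivative_transform_within_open [where S = "{..<0}"])
      (use False assms in \<open>auto simp: odd_powr_def\<close>)
qed

section \<open>From the conformable to the ordinary derivative\<close>

lemma has_vector_derivative_iff_at_0:
  fixes g :: "real \<Rightarrow> 'a::real_normed_vector"
  shows "(g has_vector_derivative D) (at t) \<longleftrightarrow> ((\<lambda>h. (g (t + h) - g t) /\<^sub>R h) \<longlongrightarrow> D) (at 0)"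
proof -
  have "norm (g (t + h) - g t - h *\<^sub>R D) / norm h = norm ((g (t + h) - g t) /\<^sub>R h - D)"
    if "h \<noteq> 0" for h
  proof -
    have "(g (t + h) - g t) /\<^sub>R h - D = (g (t + h) - g t - h *\<^sub>R D) /\<^sub>R h"
      using that by (simp add: scaleR_diff_right)
    then show ?thesis by (simp add: divide_inverse mult.commute)
  qed
  then have "((\<lambda>h. norm (g (t + h) - g t - h *\<^sub>R D) / norm h) \<longlongrightarrow> 0) (at 0) \<longleftrightarrow>
      ((\<lambda>h. norm ((g (t + h) - g t) /\<^sub>R h - D)) \<longlongrightarrow> 0) (at 0)"
    by (intro tendsto_cong) (auto simp: eventually_at_filter)
  then show ?thesis
    unfolding has_vector_derivative_def has_derivative_at
    by (simp add: tendsto_norm_zero_iff LIM_zero_iff bounded_linear_scaleR_left)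
qed

text \<open>For fixed \<open>t \<noteq> 0\<close> the increment is only rescaled by the positive
  constant \<open>c\<close>, so the defining limit is the derivative at 0 of
  \<open>\<lambda>h. g (t + h * c)\<close>. The chain rule for this affine substitution and for its
  inverse gives the two directions.\<close>

lemma has_conformable_limit_iff:
  assumes "t \<noteq> 0"
  shows "has_conformable_limit \<alpha> g D t \<longleftrightarrow>
    (g has_vector_derivative \<bar>t\<bar> powr (\<alpha> - 1) *\<^sub>R D) (at t)"
proof -
  define c where "c = \<bar>t\<bar> powr (1 - \<alpha>)"
  have c: "c > 0" "\<bar>t\<bar> powr (\<alpha> - 1) = 1 / c" using assms by (auto simp: c_def powr_minus_divide [symmetric])
  have 1: "has_conformable_limit \<alpha> g D t \<longleftrightarrow> ((\<lambda>h. g (t + h * c)) has_vector_derivative D) (at 0)"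
    by (simp add: has_conformable_limit_def has_vector_derivative_iff_at_0 c_def)
  show ?thesis unfolding 1 c
  proof
    assume *: "((\<lambda>h. g (t + h * c)) has_vector_derivative D) (at 0)"
    have "((\<lambda>s. (s - t) / c) has_vector_derivative 1 / c) (at t)"
      unfolding has_real_derivative_iff_has_vector_derivative [symmetric]
      using c by (auto intro!: derivative_eq_intros)
    from vector_diff_chain_at [OF this, of "\<lambda>h. g (t + h * c)" D] *
    show "(g has_vector_derivative (1 / c) *\<^sub>R D) (at t)" using c by (simp add: o_def)
  next
    assume *: "(g has_vector_derivative (1 / c) *\<^sub>R D) (at t)"
    have "((\<lambda>h. t + h * c) has_vector_derivative c) (at 0)"
      unfolding has_real_derivative_iff_has_vector_derivative [symmetric]
      by (auto intro!: derivative_eq_intros)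
    from vector_diff_chain_at [OF this, of g "(1 / c) *\<^sub>R D"] *
    show "((\<lambda>h. g (t + h * c)) has_vector_derivative D) (at 0)" using c by (simp add: o_def)
  qed
qed

lemma conformable_solution_iff:
  fixes A :: "real \<Rightarrow> real ^ 'n ^ 'n"
  assumes A: "continuous_on UNIV A"
  shows "conformable_solution \<alpha> A x \<longleftrightarrow> continuous_on UNIV x \<and>
    (\<forall>t. t \<noteq> 0 \<longrightarrow> (x has_vector_derivative \<bar>t\<bar> powr (\<alpha> - 1) *\<^sub>R (A t *v x t)) (at t))"
proof -
  have nonzero: "has_conformable_derivative \<alpha> x D t \<longleftrightarrow>
      (x has_vector_derivative \<bar>t\<bar> powr (\<alpha> - 1) *\<^sub>R D) (at t)" if "t \<noteq> 0" for D t
    using that by (simp add: has_conformable_derivative_def has_conformable_limit_iff)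
  have zero: "has_conformable_derivative \<alpha> x (A 0 *v x 0) 0"
    if x: "continuous_on UNIV x" and lim: "\<And>t. t \<noteq> 0 \<Longrightarrow> has_conformable_derivative \<alpha> x (A t *v x t) t"
  proof -
    \<comment> \<open>The witness for the derivatives \<open>h\<close> near the origin is the
      right-hand side \<open>\<lambda>s. A s *v x s\<close>, which is continuous at 0.\<close>
    have "((\<lambda>s. A s *v x s) \<longlongrightarrow> A 0 *v x 0) (at 0)"
      using continuous_on_matrix_vector_mult [OF A x] by (simp add: continuous_on_def)
    moreover have "\<forall>\<^sub>F s in at 0. has_conformable_limit \<alpha> x (A s *v x s) s"
      using lim by (auto simp: eventually_at_filter has_conformable_derivative_def)
    ultimately show ?thesis unfolding has_conformable_derivative_def by auto
  qed
  show ?thesis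
  proof
    assume x: "conformable_solution \<alpha> A x"
    then show "continuous_on UNIV x \<and>
      (\<forall>t. t \<noteq> 0 \<longrightarrow> (x has_vector_derivative \<bar>t\<bar> powr (\<alpha> - 1) *\<^sub>R (A t *v x t)) (at t))"
      by (simp add: conformable_solution_def flip: nonzero)
  next
    assume *: "continuous_on UNIV x \<and>
      (\<forall>t. t \<noteq> 0 \<longrightarrow> (x has_vector_derivative \<bar>t\<bar> powr (\<alpha> - 1) *\<^sub>R (A t *v x t)) (at t))"
    have "has_conformable_derivative \<alpha> x (A t *v x t) t" for t
      using * zero nonzero by (cases "t = 0") simp_all
    with * show "conformable_solution \<alpha> A x" by (simp add: conformable_solution_def)
  qed
qed

section \<open>Superposition and existence of solutions\<close>

lemma conformable_solution_linear_combination: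
  fixes A :: "real \<Rightarrow> real ^ 'n ^ 'n"
  assumes "continuous_on UNIV A" "conformable_solution \<alpha> A x" "conformable_solution \<alpha> A y"
  shows "conformable_solution \<alpha> A (\<lambda>t. a *\<^sub>R x t + b *\<^sub>R y t)"
proof -
  have "((\<lambda>t. a *\<^sub>R x t + b *\<^sub>R y t) has_vector_derivative
      \<bar>t\<bar> powr (\<alpha> - 1) *\<^sub>R (A t *v (a *\<^sub>R x t + b *\<^sub>R y t))) (at t)" if "t \<noteq> 0" for t
  proof -
    have "(x has_vector_derivative \<bar>t\<bar> powr (\<alpha> - 1) *\<^sub>R (A t *v x t)) (at t)"
      "(y has_vector_derivative \<bar>t\<bar> powr (\<alpha> - 1) *\<^sub>R (A t *v y t)) (at t)"
      using assms that by (auto simp: conformable_solution_iff)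
    then show ?thesis
      by (auto intro!: derivative_eq_intros
          simp: matrix_vector_right_distrib matrix_vector_mult_scaleR scaleR_add_right mult.commute)
  qed
  then show ?thesis
    using assms by (auto simp: conformable_solution_iff intro!: continuous_intros)
qed

lemma conformable_solution_exists:
  fixes A :: "real \<Rightarrow> real ^ 'n ^ 'n"
  assumes \<alpha>: "0 < \<alpha>" and A: "continuous_on UNIV A"
  obtains x where "conformable_solution \<alpha> A x" and "x 0 = v"
proof -
  \<comment> \<open>The argument of \<open>A\<close> is the inverse of the time change
    \<open>t \<mapsto> odd_powr \<alpha> t / \<alpha>\<close>, so \<open>B\<close> is
    \<open>A\<close> in the new time.\<close>
  define B where "B s = A (odd_powr (1 / \<alpha>) (\<alpha> * s))" for s
  have "continuous_on UNIV B"
    unfolding B_def using \<alpha>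
    by (intro continuous_on_compose2 [OF A] continuous_on_compose2 [OF continuous_on_odd_powr [of _ UNIV]]
        continuous_intros) auto
  then obtain y where y: "y 0 = v" "\<And>s. (y has_vector_derivative B s *v y s) (at s)"
    using linear_ode_exists by blast
  define x where "x t = y (odd_powr \<alpha> t / \<alpha>)" for t
  have "continuous_on UNIV y"
    using y(2) by (intro continuous_at_imp_continuous_on) (auto intro: has_vector_derivative_continuous)
  then have "continuous_on UNIV x"
    unfolding x_def using \<alpha>
    by (elim continuous_on_compose2) (auto intro!: continuous_intros continuous_on_odd_powr)
  moreover have "(x has_vector_derivative \<bar>t\<bar> powr (\<alpha> - 1) *\<^sub>R (A t *v x t)) (at t)"
    if "t \<noteq> 0" for t
  proof -
    \<comment> \<open>The speed of the time change is exactly the singular factor of the equation,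
      so the chain rule restores it.\<close>
    have "((\<lambda>t. odd_powr \<alpha> t / \<alpha>) has_vector_derivative \<bar>t\<bar> powr (\<alpha> - 1)) (at t)"
      unfolding has_real_derivative_iff_has_vector_derivative [symmetric]
      using has_real_derivative_odd_powr [OF that, of \<alpha>] \<alpha> by (auto intro!: derivative_eq_intros)
    moreover have "B (odd_powr \<alpha> t / \<alpha>) = A t"
      using \<alpha> by (simp add: B_def odd_powr_odd_powr_inverse)
    ultimately show ?thesis
      using vector_diff_chain_at [OF _ y(2), of "\<lambda>t. odd_powr \<alpha> t / \<alpha>" "\<bar>t\<bar> powr (\<alpha> - 1)" t]
      by (simp add: o_def x_def [abs_def])
  qed
  ultimately have "conformable_solution \<alpha> A x" using A by (simp add: conformable_solution_iff)
  moreover have "x 0 = v" by (simp add: x_def y(1))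
  ultimately show ?thesis using that by blast
qed

section \<open>Uniqueness of solutions\<close>

text \<open>The weight \<open>\<bar>t\<bar> powr (\<alpha> - 1)\<close> is even, so time reversal
  only produces a sign, which the coefficient matrix absorbs.\<close>

lemma conformable_solution_reflect:
  fixes A :: "real \<Rightarrow> real ^ 'n ^ 'n"
  assumes A: "continuous_on UNIV A" and x: "conformable_solution \<alpha> A x"
  shows "conformable_solution \<alpha> (\<lambda>t. - A (- t)) (\<lambda>t. x (- t))"
proof -
  have A': "continuous_on UNIV (\<lambda>t. - A (- t))"
    by (intro continuous_intros continuous_on_compose2 [OF A]) auto
  have "continuous_on UNIV (\<lambda>t. x (- t))"
    using x by (intro continuous_on_compose2 [where g = x and f = uminus, OF _ continuous_on_minus [OF continuous_on_id]])
      (auto simp: conformable_solution_def)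
  moreover have "((\<lambda>t. x (- t)) has_vector_derivative \<bar>t\<bar> powr (\<alpha> - 1) *\<^sub>R (- A (- t) *v x (- t))) (at t)"
    if "t \<noteq> 0" for t
  proof -
    have "(x has_vector_derivative \<bar>- t\<bar> powr (\<alpha> - 1) *\<^sub>R (A (- t) *v x (- t))) (at (- t))"
      using x that unfolding conformable_solution_iff [OF A] by (metis neg_equal_0_iff_equal)
    from vector_diff_chain_at [OF has_vector_derivative_minus [OF has_vector_derivative_id] this]
    show ?thesis
      by (simp add: o_def bounded_bilinear.minus_left [OF bounded_bilinear_matrix_vector_mult])
  qed
  ultimately show ?thesis unfolding conformable_solution_iff [OF A'] by auto
qed

lemma conformable_solution_zero_forward:
  fixes A :: "real \<Rightarrow> real ^ 'n ^ 'n"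
  assumes \<alpha>: "0 < \<alpha>" and A: "continuous_on UNIV A" and x: "conformable_solution \<alpha> A x"
    and "x 0 = 0" and "t \<ge> 0"
  shows "x t = 0"
proof -
  obtain M where M: "\<And>s w. s \<in> {0..t} \<Longrightarrow> norm (A s *v w) \<le> M * norm w"
    using matrix_family_bounded_on_compact [OF A compact_Icc] by metis
  \<comment> \<open>The integrating factor is exponential in the changed time, so its logarithmic
    derivative \<open>- 2 * M * c\<close> carries the same singular weight \<open>c\<close> as the
    equation.\<close>
  define E where "E s = exp (- 2 * M * (odd_powr \<alpha> s / \<alpha>))" for s
  have xc: "continuous_on S x" for S
    using x continuous_on_subset by (auto simp: conformable_solution_def)
  have "(x t \<bullet> x t) * E t \<le> (x 0 \<bullet> x 0) * E 0"
  \<comment> \<open>This form of monotonicity needs derivatives only in the open interval; at 0,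
    where \<open>x\<close> may fail to be differentiable, continuity suffices.\<close>
  proof (rule DERIV_nonpos_imp_decreasing_open [OF \<open>t \<ge> 0\<close>])
    show "continuous_on {0..t} (\<lambda>s. (x s \<bullet> x s) * E s)"
      unfolding E_def using \<alpha> by (intro continuous_intros xc continuous_on_odd_powr) auto
    fix s assume s: "0 < s" "s < t"
    define c where "c = \<bar>s\<bar> powr (\<alpha> - 1)"
    have "(x has_vector_derivative c *\<^sub>R (A s *v x s)) (at s)"
      using iffD1 [OF conformable_solution_iff [OF A] x] s(1) unfolding c_def by (metis order_less_irrefl)
    from bounded_bilinear.has_vector_derivative [OF bounded_bilinear_inner this this]
    have "((\<lambda>s. x s \<bullet> x s) has_real_derivative 2 * c * (x s \<bullet> (A s *v x s))) (at s)"
      unfolding has_real_derivative_iff_has_vector_derivative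
      by (simp add: inner_commute mult.assoc)
    moreover have "(E has_real_derivative - 2 * M * c * E s) (at s)"
    proof -
      have "(odd_powr \<alpha> has_real_derivative \<alpha> * c) (at s)"
        using has_real_derivative_odd_powr [of s \<alpha>] s by (simp add: c_def)
      then have "((\<lambda>s. - 2 * M * (odd_powr \<alpha> s / \<alpha>)) has_real_derivative - 2 * M * (\<alpha> * c / \<alpha>)) (at s)"
        by (intro DERIV_cmult DERIV_cdivide)
      from DERIV_fun_exp [OF this] show ?thesis using \<alpha> by (simp add: E_def [abs_def] mult_ac)
    qed
    ultimately have "((\<lambda>s. (x s \<bullet> x s) * E s) has_real_derivative
        2 * c * E s * (x s \<bullet> (A s *v x s) - M * (x s \<bullet> x s))) (at s)"
      using DERIV_mult by (fastforce simp: algebra_simps)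
    \<comment> \<open>Cauchy-Schwarz and the bound \<open>M\<close> make the bracket in the
      derivative nonpositive.\<close>
    moreover have "x s \<bullet> (A s *v x s) \<le> M * (x s \<bullet> x s)"
    proof -
      have "x s \<bullet> (A s *v x s) \<le> norm (x s) * norm (A s *v x s)" by (rule norm_cauchy_schwarz)
      also have "\<dots> \<le> norm (x s) * (M * norm (x s))"
        using M [of s] s by (intro mult_left_mono) auto
      finally show ?thesis by (simp add: dot_square_norm power2_eq_square mult_ac)
    qed
    then have "2 * c * E s * (x s \<bullet> (A s *v x s) - M * (x s \<bullet> x s)) \<le> 0"
      by (intro mult_nonneg_nonpos) (auto simp: c_def E_def)
    ultimately show "\<exists>y. ((\<lambda>s. (x s \<bullet> x s) * E s) has_real_derivative y) (at s) \<and> y \<le> 0" by blast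
  qed
  then have "(x t \<bullet> x t) * E t \<le> 0" using \<open>x 0 = 0\<close> by simp
  moreover have "E t > 0" by (simp add: E_def)
  ultimately have "x t \<bullet> x t \<le> 0" by (simp add: mult_le_0_iff)
  then have "x t \<bullet> x t = 0" by (intro antisym) auto
  then show ?thesis by simp
qed

lemma conformable_solution_zero:
  fixes A :: "real \<Rightarrow> real ^ 'n ^ 'n"
  assumes "0 < \<alpha>" "continuous_on UNIV A" "conformable_solution \<alpha> A x" "x 0 = 0"
  shows "x t = 0"
proof (cases "t \<ge> 0")
  case False
  have "continuous_on UNIV (\<lambda>t. - A (- t))"
    by (intro continuous_intros continuous_on_compose2 [OF assms(2)]) auto
  from conformable_solution_zero_forward [OF assms(1) this
      conformable_solution_reflect [OF assms(2,3)], of "- t"] assms(4) False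
  show ?thesis by simp
qed (use conformable_solution_zero_forward assms in blast)

lemma conformable_solution_unique:
  fixes A :: "real \<Rightarrow> real ^ 'n ^ 'n"
  assumes "0 < \<alpha>" "continuous_on UNIV A"
    and "conformable_solution \<alpha> A x" "conformable_solution \<alpha> A y" "x 0 = y 0"
  shows "x = y"
proof
  fix t
  have "conformable_solution \<alpha> A (\<lambda>t. 1 *\<^sub>R x t + (- 1) *\<^sub>R y t)"
    using assms by (intro conformable_solution_linear_combination)
  from conformable_solution_zero [OF assms(1,2) this] assms(5) show "x t = y t" by simp
qed

section \<open>The solution space and its dimension\<close>

theorem proposition2p5:
  fixes \<alpha> :: real and A :: "real \<Rightarrow> real ^ 'n ^ 'n"
  assumes "0 < \<alpha>" and "\<alpha> \<le> 1" and "continuous_on UNIV A"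
  shows "(\<forall>x1 x2 a1 a2. conformable_solution \<alpha> A x1 \<longrightarrow> conformable_solution \<alpha> A x2 \<longrightarrow>
            conformable_solution \<alpha> A (\<lambda>t. a1 *\<^sub>R x1 t + a2 *\<^sub>R x2 t))
       \<and> fun_space.subspace {x. conformable_solution \<alpha> A x}
       \<and> fun_space.dim {x. conformable_solution \<alpha> A x} = CARD('n)"
proof (intro conjI allI impI)
  let ?V = "{x. conformable_solution \<alpha> A x}"
  note comb = conformable_solution_linear_combination [OF assms(3)]
  show "conformable_solution \<alpha> A (\<lambda>t. a1 *\<^sub>R x1 t + a2 *\<^sub>R x2 t)"
    if "conformable_solution \<alpha> A x1" "conformable_solution \<alpha> A x2" for x1 x2 a1 a2
    by (rule comb [OF that])
  \<comment> \<open>\<open>Y v\<close> is the solution with initial value \<open>v\<close>; by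
    uniqueness \<open>Y\<close> inverts the evaluation at 0 on the solutions.\<close>
  obtain Y where Y: "\<And>v. conformable_solution \<alpha> A (Y v)" "\<And>v. Y v 0 = v"
  proof -
    have "\<exists>x. conformable_solution \<alpha> A x \<and> x 0 = v" for v
      by (rule conformable_solution_exists [OF assms(1,3), of v]) blast
    then show thesis using that by metis
  qed
  have Y_eq: "x = Y (x 0)" if "conformable_solution \<alpha> A x" for x
    using conformable_solution_unique [OF assms(1,3) that Y(1)] Y(2) by simp
  show "fun_space.subspace ?V"
    unfolding fun_space.subspace_def
  proof (intro conjI ballI allI)
    show "0 \<in> ?V" using comb [OF Y(1) Y(1), of 0 _ 0] by (simp add: zero_fun_def)
    show "x + y \<in> ?V" if "x \<in> ?V" "y \<in> ?V" for x y
      using comb [of \<alpha> x y 1 1] that by (simp add: plus_fun_def)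
    show "scale_fun c x \<in> ?V" if "x \<in> ?V" for c x
      using comb [of \<alpha> x x c 0] that by (simp add: scale_fun_def)
  qed
  interpret pair: vector_space_pair "(*\<^sub>R) :: real \<Rightarrow> real ^ 'n \<Rightarrow> real ^ 'n"
    "scale_fun :: real \<Rightarrow> (real \<Rightarrow> real ^ 'n) \<Rightarrow> real \<Rightarrow> real ^ 'n" ..
  \<comment> \<open>A linear combination of solutions is again a solution, hence it is
    \<open>Y\<close> of its own value at 0. For scaling, the second summand gets coefficient
    0.\<close>
  have lin: "Vector_Spaces.linear (*\<^sub>R) scale_fun Y"
  proof unfold_locales
    show "Y (v + w) = Y v + Y w" for v w
      using Y_eq [OF comb [OF Y(1) Y(1), of 1 v 1 w]] by (simp add: Y(2) plus_fun_def)
    show "Y (c *\<^sub>R v) = scale_fun c (Y v)" for c v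
      using Y_eq [OF comb [OF Y(1) Y(1), of c v 0 v]] by (simp add: Y(2) scale_fun_def)
  qed
  have inj: "inj Y" by (metis Y(2) injI)
  show "fun_space.dim ?V = CARD('n)"
  \<comment> \<open>The basis is the image under \<open>Y\<close> of the standard basis. It spans
    because every solution is some \<open>Y v\<close>, and it is independent because
    \<open>Y\<close> is linear and injective.\<close>
  proof (rule fun_space.dim_unique)
    show "Y ` Basis \<subseteq> ?V" using Y(1) by auto
    have "fun_space.span (Y ` Basis) = Y ` span Basis"
      using pair.linear_span_image [OF lin] by (simp add: span_raw_def)
    then show "?V \<subseteq> fun_space.span (Y ` Basis)" using Y_eq by (auto simp: span_Basis)
    show "fun_space.independent (Y ` Basis)"
      using pair.linear_independent_injective_image [OF lin] independent_Basis inj_on_subset [OF inj]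
      by (auto simp: dependent_raw_def)
    show "card (Y ` Basis) = CARD('n)"
      using inj by (simp add: card_image inj_on_subset [OF inj])
  qed
qed

end
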